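(* For every integer $n\ge 0$, the polynomial $y=H_n(x)$ satisfies Jacobi's differential equation $$ (x^2-1)\,\frac{d^2y}{dx^2} + (2x+1)\,\frac{dy}{dx} - n(n+1)\,y = 0, $$ and, in terms of the Jacobi polynomials, $$ H_n(x) = (-4)^n \frac{(n!)^2}{(2 n)!}\, P_n^{( \frac12 , - \frac12)} (x), \qquad H_n^{(2,1)}(x) = (-4)^n \frac{(n!)^2}{(2 n)!}\, P_n^{( \frac12 , - \frac12)} (x-1). $$
   Context: For $k\ge 0$ let $a_k(x)=\sum_{m=0}^{k}\binom{2k+2}{k-m}x^m$ and $a_k^{(2,1)}(x)=\sum_{m=0}^{k}\binom{2k+1-m}{k-m}x^m$. For $n\ge 0$ let $H_n(x)=\det[a_{i+j}(x)]_{0\le i,j\le n}$ and $H_n^{(2,1)}(x)=\det[a_{i+j}^{(2,1)}(x)]_{0\le i,j\le n}$. $P_n^{(\alpha,\beta)}$ denotes the Jacobi polynomial of degree $n$ with the standard normalization $P_n^{(\alpha,\beta)}(1)=\binom{n+\alpha}{n}$. *)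

theory Defs
  imports "Jordan_Normal_Form.Determinant" "HOL-Computational_Algebra.Polynomial"
begin

text \<open>In both families the subtractions never truncate, since the summation index
  \<open>m\<close> is at most \<open>k\<close>.\<close>

definition a_poly :: "nat \<Rightarrow> real poly" where
  "a_poly k = (\<Sum>m=0..k. Polynomial.monom (of_nat ((2 * k + 2) choose (k - m))) m)"

definition a21_poly :: "nat \<Rightarrow> real poly" where
  "a21_poly k = (\<Sum>m=0..k. Polynomial.monom (of_nat ((2 * k + 1 - m) choose (k - m))) m)"

definition hankel_det :: "(nat \<Rightarrow> 'a :: comm_ring_1) \<Rightarrow> nat \<Rightarrow> 'a" where
  "hankel_det a n = det (mat (n + 1) (n + 1) (\<lambda>(i, j). a (i + j)))"

definition H_poly :: "nat \<Rightarrow> real poly" where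
  "H_poly n = hankel_det a_poly n"

definition H21_poly :: "nat \<Rightarrow> real poly" where
  "H21_poly n = hankel_det a21_poly n"

text \<open>The Jacobi polynomial in the standard explicit form
  \<open>\<Sum>\<^sub>s C(n + \<alpha>, n - s) C(n + \<beta>, s) ((x - 1) / 2)\<^sup>s ((x + 1) / 2)\<^sup>n\<^sup>-\<^sup>s\<close>,
  obtained from Rodrigues' formula by the Leibniz rule.\<close>

definition jacobi_poly :: "real \<Rightarrow> real \<Rightarrow> nat \<Rightarrow> real poly" where
  "jacobi_poly \<alpha> \<beta> n =
     (\<Sum>s=0..n. Polynomial.smult (((real n + \<alpha>) gchoose (n - s)) * ((real n + \<beta>) gchoose s))
        ([:- 1 / 2, 1 / 2:] ^ s * [:1 / 2, 1 / 2:] ^ (n - s)))"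

lemma poly_jacobi_poly_1: "poly (jacobi_poly \<alpha> \<beta> n) 1 = (real n + \<alpha>) gchoose n"
proof -
  have "poly (jacobi_poly \<alpha> \<beta> n) 1 =
      (\<Sum>s=0..n. if s = 0 then (real n + \<alpha>) gchoose n else 0)"
    unfolding jacobi_poly_def poly_sum by (intro sum.cong) auto
  then show ?thesis
    by simp
qed

end

theory Submission
  imports Defs
begin

text \<open>
  Both determinants are, up to sign, Chebyshev polynomials of the fourth kind: with
  \<open>W\<^sub>0 = 1\<close>, \<open>W\<^sub>1 = 2x + 1\<close>, \<open>W\<^sub>n\<^sub>+\<^sub>2 = 2x W\<^sub>n\<^sub>+\<^sub>1 - W\<^sub>n\<close>, one has \<open>H\<^sub>n(x) = (-1)\<^sup>n W\<^sub>n(x)\<close>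
  (\<open>H_poly_eq_cheb4\<close>) and the determinant of the second family is \<open>(-1)\<^sup>n W\<^sub>n(x - 1)\<close>
  (\<open>H21_poly_eq_cheb4\<close>). The second claim follows from the first since the entries of the second family
  are those of the first at \<open>x - 1\<close> (\<open>a21_sum_shift\<close>).

  For the determinant, \<open>a\<^sub>k(x)\<close> is the \<open>k\<close>-th moment \<open>L (u\<^sup>k)\<close> of the functional
  \<open>L(F) =\<close> constant term of \<open>F \<cdot> (1 + s)\<^sup>2 / (1 - x s)\<close>, where \<open>u = s + 2 + 1/s\<close>. So \<open>H\<^sub>n\<close> is the
  Gram determinant of \<open>1, u, \<dots>, u\<^sup>n\<close> for the form \<open>L (f g)\<close>, and any monic basis in \<open>u\<close> gives the same
  determinant. In the basis \<open>p\<^sub>k = s\<^sup>k - s\<^sup>k\<^sup>-\<^sup>1 + \<dots> + s\<^sup>-\<^sup>k\<close> the Gram matrix has the entries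
  \<open>x\<^sup>i\<^sup>+\<^sup>j\<close>, plus \<open>x\<close> to the power \<open>\<bar>i - j\<bar> - 1\<close> if \<open>i \<noteq> j\<close> (\<open>gram\<close>, \<open>binom_transform_gram\<close>), and in the basis
  \<open>p\<^sub>k - x p\<^sub>k\<^sub>-\<^sub>1\<close> it is tridiagonal (\<open>bidiag_gram\<close>); expansion along the last row is then the recurrence
  of \<open>W\<^sub>n\<close>. The functional is not formalized: its effect on the basis \<open>p\<close> is described by finite sums.

  The Jacobi form is a comparison of \<open>W\<^sub>n = \<Sum>\<^sub>s C(2n+1, 2s+1) ((x-1)/2)\<^sup>s ((x+1)/2)\<^sup>n\<^sup>-\<^sup>s\<close> with the explicit
  Jacobi sum (\<open>jacobi_coefficient\<close>, \<open>cheb4_eq_sum\<close>). The differential equation follows from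
  \<open>2 (x\<^sup>2 - 1) W\<^sub>n' = (2n + 1) W\<^sub>n\<^sub>+\<^sub>1 - (2 (n + 1) x + 1) W\<^sub>n\<close> (\<open>cheb4_deriv\<close>).
\<close>

section \<open>Chebyshev polynomials of the fourth kind\<close>

text \<open>Chebyshev polynomials of the fourth kind,
  \<open>W\<^sub>n(cos \<theta>) = sin ((n + 1/2) \<theta>) / sin (\<theta>/2)\<close>, evaluated at a ring element. Taking \<open>x\<close> in
  an arbitrary commutative ring covers numbers as well as polynomials.\<close>

fun cheb4 :: "'a::comm_ring_1 \<Rightarrow> nat \<Rightarrow> 'a" where
  "cheb4 x 0 = 1"
| "cheb4 x (Suc 0) = 2 * x + 1"
| "cheb4 x (Suc (Suc n)) = 2 * x * cheb4 x (Suc n) - cheb4 x n"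

lemma poly_cheb4: "poly (cheb4 p n) y = cheb4 (poly p y) n"
  by (induction n rule: induct_nat_012) auto

lemma pcompose_cheb4: "pcompose (cheb4 p n) q = cheb4 (pcompose p q) n"
proof -
  have "pcompose 1 q = 1" "pcompose 2 q = 2"
    by (simp_all add: one_pCons pcompose_const numeral_poly)
  then show ?thesis
    by (induction n rule: induct_nat_012) (auto simp: pcompose_diff pcompose_mult pcompose_add)
qed

section \<open>Moments in a Laurent polynomial basis\<close>

text \<open>Let \<open>u = s + 2 + 1/s\<close>, let \<open>L\<close> be the functional taking a Laurent polynomial \<open>F\<close> in \<open>s\<close>
  to the constant term of \<open>F \<cdot> (1 + s)\<^sup>2 / (1 - x s)\<close>, expanded in powers of \<open>s\<close>, and put
  \<open>p\<^sub>k = s\<^sup>k - s\<^sup>k\<^sup>-\<^sup>1 + \<dots> + s\<^sup>-\<^sup>k\<close>, which is monic of degree \<open>k\<close> in \<open>u\<close>. The entry \<open>gram x i j\<close> is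
  \<open>L (p\<^sub>i p\<^sub>j)\<close>: since \<open>(1 + s) p\<^sub>k = s\<^sup>k\<^sup>+\<^sup>1 + s\<^sup>-\<^sup>k\<close>, it equals the constant term of
  \<open>(s\<^sup>i\<^sup>+\<^sup>1 + s\<^sup>-\<^sup>i) (s\<^sup>j\<^sup>+\<^sup>1 + s\<^sup>-\<^sup>j) / (1 - x s)\<close>.\<close>

definition gram :: "'a::comm_ring_1 \<Rightarrow> nat \<Rightarrow> nat \<Rightarrow> 'a" where
  "gram x i j = x ^ (i + j) + (if i < j then x ^ (j - i - 1) else if j < i then x ^ (i - j - 1) else 0)"

text \<open>Multiplication by \<open>u\<close>: if \<open>f k = L (p\<^sub>k g)\<close>, then \<open>refl_lap f k = L (u p\<^sub>k g)\<close>, because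
  \<open>u p\<^sub>k = p\<^sub>k\<^sub>-\<^sub>1 + 2 p\<^sub>k + p\<^sub>k\<^sub>+\<^sub>1\<close> with the reflecting boundary condition \<open>p\<^sub>-\<^sub>1 = p\<^sub>0\<close>. The truncated
  subtraction \<open>0 - 1 = 0\<close> encodes this boundary condition.\<close>

definition refl_lap :: "(nat \<Rightarrow> 'a::comm_ring_1) \<Rightarrow> nat \<Rightarrow> 'a" where
  "refl_lap f k = f (k - 1) + 2 * f k + f (Suc k)"

text \<open>This is the identity \<open>L (u p\<^sub>k \<cdot> p\<^sub>l) = L (p\<^sub>k \<cdot> u p\<^sub>l)\<close>; it makes the entries of the transformed
  matrix depend on \<open>i + j\<close> only.\<close>

lemma refl_lap_gram: "refl_lap (\<lambda>k. gram x k l) k = refl_lap (\<lambda>l. gram x k l) l"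
proof -
  consider "k = l" | d where "l = k + Suc d" | d where "k = l + Suc d"
    by (metis less_imp_Suc_add linorder_cases add_Suc_right)
  then show ?thesis
    by cases (cases k; cases l; auto simp: refl_lap_def gram_def algebra_simps Suc_diff_Suc; fail)+
qed

text \<open>Multiplication by \<open>u\<^sup>i\<close> at \<open>p\<^sub>0 = 1\<close>: if \<open>f k = L (p\<^sub>k g)\<close>, then \<open>binom_transform i f = L (u\<^sup>i g)\<close>,
  because \<open>u\<^sup>i = \<Sum>\<^sub>k C(2i+1, i-k) p\<^sub>k\<close>. The coefficient is written as \<open>C(2i+1, i+1+k)\<close>, which needs no
  truncated subtraction and vanishes for \<open>k > i\<close>.\<close>

definition binom_transform :: "nat \<Rightarrow> (nat \<Rightarrow> 'a::comm_ring_1) \<Rightarrow> 'a" where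
  "binom_transform i f = (\<Sum>k\<le>i. of_nat ((2 * i + 1) choose (i + 1 + k)) * f k)"

lemma binom_transform_Suc: "binom_transform (Suc i) f = binom_transform i (refl_lap f)"
proof -
  define c where "c k = (of_nat ((2 * i + 1) choose (i + 1 + k)) :: 'a)" for k
  have c0: "c k = 0" if "k > i" for k
    using that by (simp add: c_def binomial_eq_0)
  have transform: "binom_transform i g = (\<Sum>k\<le>i. c k * g k)" for g
    by (simp only: binom_transform_def c_def)
  have sym: "(2 * i + 1) choose i = (2 * i + 1) choose (i + 1)"
    by (subst binomial_symmetric) auto
  \<comment> \<open>Pascal's rule twice; for \<open>k = 0\<close> the missing term \<open>c (-1)\<close> equals \<open>c 0\<close> by \<open>sym\<close>.\<close>
  have step: "of_nat ((2 * Suc i + 1) choose (Suc i + 1 + k)) = c (k - 1) + 2 * c k + c (Suc k)" for k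
    using sym by (cases k) (simp_all add: c_def algebra_simps)
  have "binom_transform (Suc i) f
        = (\<Sum>k\<le>Suc i. c (k - 1) * f k) + (\<Sum>k\<le>Suc i. 2 * c k * f k) + (\<Sum>k\<le>Suc i. c (Suc k) * f k)"
    unfolding binom_transform_def step by (simp only: distrib_right sum.distrib)
  also have "(\<Sum>k\<le>Suc i. c (k - 1) * f k) = c 0 * f 0 + (\<Sum>k\<le>i. c k * f (Suc k))"
    by (subst sum.atMost_Suc_shift) simp
  also have "(\<Sum>k\<le>Suc i. 2 * c k * f k) = (\<Sum>k\<le>i. 2 * c k * f k)"
    by (simp add: c0)
  also have "c 0 * f 0 + (\<Sum>k\<le>i. c k * f (Suc k)) + (\<Sum>k\<le>i. 2 * c k * f k) + (\<Sum>k\<le>Suc i. c (Suc k) * f k)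
     = (\<Sum>k\<le>i. c k * f (Suc k)) + (\<Sum>k\<le>i. 2 * c k * f k) + (c 0 * f 0 + (\<Sum>k\<le>Suc i. c (Suc k) * f k))"
    by (simp only: add_ac)
  also have "c 0 * f 0 + (\<Sum>k\<le>Suc i. c (Suc k) * f k) = (\<Sum>k\<le>Suc (Suc i). c k * f (k - 1))"
    by (subst (2) sum.atMost_Suc_shift) simp
  also have "(\<Sum>k\<le>Suc (Suc i). c k * f (k - 1)) = (\<Sum>k\<le>i. c k * f (k - 1))"
    by (simp add: c0)
  finally show ?thesis
    by (simp add: transform refl_lap_def sum.distrib algebra_simps)
qed

lemma refl_lap_binom_transform:
  "refl_lap (\<lambda>k. binom_transform j (f k)) = (\<lambda>k. binom_transform j (\<lambda>l. refl_lap (\<lambda>k. f k l) k))"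
  by (simp add: refl_lap_def binom_transform_def fun_eq_iff sum.distrib sum_distrib_left algebra_simps)

lemma binom_transform_gram_shift:
  "binom_transform (Suc i) (\<lambda>k. binom_transform j (gram x k))
   = binom_transform i (\<lambda>k. binom_transform (Suc j) (gram x k))"
  by (simp add: binom_transform_Suc refl_lap_binom_transform refl_lap_gram)

text \<open>The moments \<open>L (u\<^sup>i\<^sup>+\<^sup>j)\<close>: shifting all powers of \<open>u\<close> to one side reduces this to \<open>j = 0\<close>.\<close>

lemma binom_transform_gram:
  "binom_transform i (\<lambda>k. binom_transform j (gram x k))
   = (\<Sum>m\<le>i + j. of_nat ((2 * (i + j) + 2) choose (i + j - m)) * x ^ m)"
proof (induction j arbitrary: i)
  case (Suc j)
  show ?case
    using Suc.IH[of "Suc i"] by (simp only: binom_transform_gram_shift add_Suc add_Suc_right)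
next
  case 0
  define c where "c k = (of_nat ((2 * i + 1) choose (i + 1 + k)) :: 'a)" for k
  have pascal: "c m + c (Suc m) = of_nat ((2 * i + 2) choose (i - m))" if "m \<le> i" for m
  proof -
    have "(2 * i + 2) choose (i - m) = (2 * i + 2) choose (i + 2 + m)"
      using that by (subst binomial_symmetric) (auto intro!: arg_cong2[of _ _ _ _ binomial])
    then show ?thesis
      by (simp add: c_def)
  qed
  have "gram x k 0 = x ^ k + (if k = 0 then 0 else x ^ (k - 1))" for k
    by (simp add: gram_def)
  then have "binom_transform i (\<lambda>k. gram x k 0)
      = (\<Sum>k\<le>i. c k * x ^ k) + (\<Sum>k\<le>i. c k * (if k = 0 then 0 else x ^ (k - 1)))"
    by (simp only: binom_transform_def c_def distrib_left sum.distrib)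
  also have "(\<Sum>k\<le>i. c k * (if k = 0 then 0 else x ^ (k - 1))) = (\<Sum>k<i. c (Suc k) * x ^ k)"
    by (simp only: sum.atMost_shift) simp
  also have "\<dots> = (\<Sum>k\<le>i. c (Suc k) * x ^ k)"
    by (simp add: c_def binomial_eq_0 flip: lessThan_Suc_atMost)
  also have "(\<Sum>k\<le>i. c k * x ^ k) + \<dots> = (\<Sum>k\<le>i. of_nat ((2 * i + 2) choose (i - k)) * x ^ k)"
    unfolding sum.distrib[symmetric] distrib_right[symmetric]
    by (intro sum.cong refl) (simp only: pascal atMost_iff)
  finally show ?case
    by (simp add: binom_transform_def[of 0])
qed

section \<open>The second family as a shift of the first\<close>

text \<open>An upper-index form of Vandermonde's convolution.\<close>

lemma sum_choose_mult_choose: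
  "(\<Sum>m\<le>n. ((n - m) choose r) * (m choose j)) = Suc n choose (r + j + 1)"
proof (induction n arbitrary: r)
  case (Suc n)
  show ?case
  proof (cases r)
    case 0
    then show ?thesis
      using sum_choose_upper[of j "Suc n"] by simp
  next
    case (Suc q)
    have "(\<Sum>m\<le>Suc n. ((Suc n - m) choose r) * (m choose j))
        = (\<Sum>m\<le>n. (Suc (n - m) choose r) * (m choose j))"
      using Suc by (simp add: Suc_diff_le)
    also have "\<dots> = (\<Sum>m\<le>n. ((n - m) choose q) * (m choose j)) + (\<Sum>m\<le>n. ((n - m) choose r) * (m choose j))"
      using Suc by (simp add: distrib_right sum.distrib)
    also have "\<dots> = Suc (Suc n) choose (r + j + 1)"
      using Suc by (simp only: Suc.IH) simp
    finally show ?thesis .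
  qed
next
  case 0
  show ?case
    by (cases r; cases j) simp_all
qed

text \<open>The second family is the first one at a shifted argument.\<close>

lemma a21_sum_shift:
  fixes y :: "'a::comm_ring_1"
  shows "(\<Sum>m\<le>k. of_nat ((2 * k + 1 - m) choose (k - m)) * (y + 1) ^ m)
       = (\<Sum>m\<le>k. of_nat ((2 * k + 2) choose (k - m)) * y ^ m)"
proof -
  have "(\<Sum>m\<le>k. of_nat ((2 * k + 1 - m) choose (k - m)) * (y + 1) ^ m)
      = (\<Sum>m\<le>k. \<Sum>j\<le>k. of_nat (((2 * k + 1 - m) choose (k + 1)) * (m choose j)) * y ^ j)"
  proof (intro sum.cong refl)
    fix m
    assume "m \<in> {..k}"
    then have m: "m \<le> k" by simp
    have "(2 * k + 1 - m) choose (k - m) = (2 * k + 1 - m) choose (k + 1)"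
      using m by (subst binomial_symmetric) (auto intro!: arg_cong2[of _ _ _ _ binomial])
    moreover have "(y + 1) ^ m = (\<Sum>j\<le>m. of_nat (m choose j) * y ^ j)"
      by (simp add: binomial_ring)
    moreover have "\<dots> = (\<Sum>j\<le>k. of_nat (m choose j) * y ^ j)"
      using m by (intro sum.mono_neutral_left) (auto simp: binomial_eq_0)
    ultimately show "of_nat ((2 * k + 1 - m) choose (k - m)) * (y + 1) ^ m
        = (\<Sum>j\<le>k. of_nat (((2 * k + 1 - m) choose (k + 1)) * (m choose j)) * y ^ j)"
      by (simp only: sum_distrib_left of_nat_mult mult.assoc)
  qed
  also have "\<dots> = (\<Sum>j\<le>k. of_nat (\<Sum>m\<le>k. ((2 * k + 1 - m) choose (k + 1)) * (m choose j)) * y ^ j)"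
    by (subst sum.swap) (simp only: of_nat_sum sum_distrib_right)
  also have "\<dots> = (\<Sum>j\<le>k. of_nat ((2 * k + 2) choose (k - j)) * y ^ j)"
  proof (intro sum.cong refl)
    fix j
    assume "j \<in> {..k}"
    then have j: "j \<le> k" by simp
    have "(\<Sum>m\<le>k. ((2 * k + 1 - m) choose (k + 1)) * (m choose j))
        = (\<Sum>m\<le>2 * k + 1. ((2 * k + 1 - m) choose (k + 1)) * (m choose j))"
      by (intro sum.mono_neutral_left) (auto simp: binomial_eq_0)
    also have "\<dots> = (2 * k + 2) choose (k + 1 + j + 1)"
      by (simp only: sum_choose_mult_choose) simp
    also have "\<dots> = (2 * k + 2) choose (k - j)"
      using j by (subst binomial_symmetric) (auto intro!: arg_cong2[of _ _ _ _ binomial])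
    finally show "of_nat (\<Sum>m\<le>k. ((2 * k + 1 - m) choose (k + 1)) * (m choose j)) * y ^ j
        = of_nat ((2 * k + 2) choose (k - j)) * y ^ j"
      by simp
  qed
  finally show ?thesis .
qed

section \<open>The Hankel determinants\<close>

text \<open>A unitriangular change of basis does not change a Gram determinant.\<close>

lemma det_unit_lower_triangular_congruence:
  fixes L M :: "nat \<Rightarrow> nat \<Rightarrow> 'a::comm_ring_1"
  assumes diag: "\<And>i. L i i = 1" and lower: "\<And>i k. i < k \<Longrightarrow> L i k = 0"
  shows "det (mat n n (\<lambda>(i, j). \<Sum>k<n. L i k * (\<Sum>l<n. L j l * M k l))) = det (mat n n (\<lambda>(i, j). M i j))"
proof -
  define A where "A = mat n n (\<lambda>(i, j). L i j)"
  define B where "B = mat n n (\<lambda>(i, j). M i j)"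
  have carrier: "A \<in> carrier_mat n n" "B \<in> carrier_mat n n" "transpose_mat A \<in> carrier_mat n n"
    by (auto simp: A_def B_def)
  have "det A = prod_list (diag_mat A)"
    by (rule det_lower_triangular[of n]) (auto simp: A_def lower)
  also have "diag_mat A = map (\<lambda>_. 1) [0..<n]"
    by (auto simp: diag_mat_def A_def diag)
  also have "prod_list (map (\<lambda>_. 1 :: 'a) [0..<n]) = 1"
    by (induction n) auto
  finally have det_A: "det A = 1" .
  have "mat n n (\<lambda>(i, j). \<Sum>k<n. L i k * (\<Sum>l<n. L j l * M k l)) = A * (B * transpose_mat A)"
    by (rule eq_matI)
      (auto simp: A_def B_def scalar_prod_def atLeast0LessThan mult.commute intro!: sum.cong)
  also have "det \<dots> = det A * (det B * det (transpose_mat A))"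
    using carrier by (simp add: det_mult[of _ n])
  also have "\<dots> = det B"
    using carrier by (simp add: det_A det_transpose)
  finally show ?thesis
    by (simp add: B_def)
qed

text \<open>The three-term recurrence for continuants.\<close>

lemma det_tridiagonal:
  fixes f :: "nat \<Rightarrow> nat \<Rightarrow> 'a::comm_ring_1"
  assumes tridiag: "\<And>i j. Suc i < j \<or> Suc j < i \<Longrightarrow> f i j = 0"
  defines "D \<equiv> \<lambda>n. det (mat n n (\<lambda>(i, j). f i j))"
  shows "D (Suc (Suc n)) = f (Suc n) (Suc n) * D (Suc n) - f n (Suc n) * f (Suc n) n * D n"
proof -
  define A where "A = mat (Suc (Suc n)) (Suc (Suc n)) (\<lambda>(i, j). f i j)"
  define B where "B = mat_delete A (Suc n) n"
  have A: "A \<in> carrier_mat (Suc (Suc n)) (Suc (Suc n))" and B: "B \<in> carrier_mat (Suc n) (Suc n)"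
    by (auto simp: A_def B_def mat_delete_def)
  \<comment> \<open>The last column of this minor has a single nonzero entry, its bottom one.\<close>
  have "det B = (\<Sum>i<Suc n. B $$ (i, n) * cofactor B i n)"
    by (rule laplace_expansion_column[OF B]) simp
  also have "\<dots> = B $$ (n, n) * cofactor B n n"
    by (auto simp: B_def A_def mat_delete_def tridiag)
  also have "cofactor B n n = D n"
    unfolding cofactor_def D_def
    by (auto simp: B_def A_def mat_delete_def simp flip: power_add mult_2 intro!: arg_cong[of _ _ det] eq_matI)
  also have "B $$ (n, n) = f n (Suc n)"
    by (simp add: B_def A_def mat_delete_def)
  finally have det_B: "det B = f n (Suc n) * D n" .
  have "D (Suc (Suc n)) = (\<Sum>j<Suc (Suc n). A $$ (Suc n, j) * cofactor A (Suc n) j)"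
    unfolding D_def A_def[symmetric] by (rule laplace_expansion_row[OF A]) simp
  also have "\<dots> = f (Suc n) n * cofactor A (Suc n) n + f (Suc n) (Suc n) * cofactor A (Suc n) (Suc n)"
    by (auto simp: A_def tridiag)
  also have "cofactor A (Suc n) n = - det B"
    by (simp add: cofactor_def B_def flip: mult_2)
  also have "cofactor A (Suc n) (Suc n) = D (Suc n)"
    unfolding cofactor_def D_def
    by (auto simp: A_def mat_delete_def simp flip: mult_2 intro!: arg_cong[of _ _ det] eq_matI)
  finally show ?thesis
    by (simp add: det_B algebra_simps)
qed

text \<open>The tridiagonal matrix with superdiagonal and subdiagonal \<open>1\<close> and diagonal \<open>1, -2x, -2x, \<dots>\<close>;
  it is the matrix of \<open>L (q\<^sub>i q\<^sub>j)\<close> for \<open>q\<^sub>0 = p\<^sub>0\<close> and \<open>q\<^sub>k = p\<^sub>k - x p\<^sub>k\<^sub>-\<^sub>1\<close>.\<close>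

definition cheb4_band :: "'a::comm_ring_1 \<Rightarrow> nat \<Rightarrow> nat \<Rightarrow> 'a" where
  "cheb4_band x i j =
     (if i = j then if i = 0 then 1 else - 2 * x else if i = Suc j \<or> j = Suc i then 1 else 0)"

lemma det_cheb4_band:
  "det (mat (Suc n) (Suc n) (\<lambda>(i, j). cheb4_band x i j)) = (- 1) ^ n * cheb4 x n"
proof -
  define D where "D n = det (mat n n (\<lambda>(i, j). cheb4_band x i j))" for n
  have rec: "D (Suc (Suc n)) = cheb4_band x (Suc n) (Suc n) * D (Suc n)
      - cheb4_band x n (Suc n) * cheb4_band x (Suc n) n * D n" for n
    unfolding D_def by (rule det_tridiagonal) (auto simp: cheb4_band_def)
  have D0: "D 0 = 1" and D1: "D (Suc 0) = 1"
    by (simp_all add: D_def det_single cheb4_band_def)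
  have "D (Suc n) = (- 1) ^ n * cheb4 x n"
  proof (induction n rule: induct_nat_012)
    case 1
    show ?case
      using rec[of 0] by (simp add: D0 D1 cheb4_band_def)
  next
    case (ge2 n)
    then show ?case
      using rec[of "Suc n"] by (simp add: cheb4_band_def algebra_simps)
  qed (simp add: D1)
  then show ?thesis
    by (simp add: D_def)
qed

text \<open>The change of basis from \<open>p\<close> to \<open>q\<close>.\<close>

definition bidiag :: "'a::comm_ring_1 \<Rightarrow> nat \<Rightarrow> nat \<Rightarrow> 'a" where
  "bidiag x i k = (if k = i then 1 else if i = Suc k then - x else 0)"

lemma sum_bidiag:
  assumes "i < n"
  shows "(\<Sum>k<n. bidiag x i k * f k) = f i - (if i = 0 then 0 else x * f (i - 1))"
proof -
  have "(\<Sum>k<n. bidiag x i k * f k) = (\<Sum>k<n. (if k = i then f k else 0) + (if i \<noteq> 0 \<and> k = i - 1 then - x * f k else 0))"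
    by (intro sum.cong) (auto simp: bidiag_def)
  also have "\<dots> = f i - (if i = 0 then 0 else x * f (i - 1))"
    using assms by (cases "i = 0") (auto simp: sum.distrib)
  finally show ?thesis .
qed

lemma bidiag_gram:
  assumes "i < n" "j < n"
  shows "(\<Sum>k<n. bidiag x i k * (\<Sum>l<n. bidiag x j l * gram x k l)) = cheb4_band x i j"
proof -
  have "(\<Sum>k<n. bidiag x i k * (\<Sum>l<n. bidiag x j l * gram x k l))
    = gram x i j - (if j = 0 then 0 else x * gram x i (j - 1))
      - (if i = 0 then 0 else x * (gram x (i - 1) j - (if j = 0 then 0 else x * gram x (i - 1) (j - 1))))"
    by (simp only: sum_bidiag assms)
  note expand = this
  consider "i = j" | d where "j = i + Suc d" | d where "i = j + Suc d"
    by (metis less_imp_Suc_add linorder_cases add_Suc_right)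
  then show ?thesis
  proof cases
    case 1
    then show ?thesis unfolding expand
      by (cases i) (auto simp: gram_def cheb4_band_def eval_nat_numeral power_add algebra_simps)
  next
    case 2
    then show ?thesis unfolding expand
      by (cases i; cases d; cases "d - 1") (auto simp: gram_def cheb4_band_def eval_nat_numeral power_add algebra_simps)
  next
    case 3
    then show ?thesis unfolding expand
      by (cases j; cases d; cases "d - 1") (auto simp: gram_def cheb4_band_def eval_nat_numeral power_add algebra_simps)
  qed
qed

lemma det_gram:
  "det (mat (Suc n) (Suc n) (\<lambda>(i, j). gram x i j)) = (- 1) ^ n * cheb4 x n"
proof -
  have "det (mat (Suc n) (Suc n) (\<lambda>(i, j). gram x i j))
      = det (mat (Suc n) (Suc n) (\<lambda>(i, j). \<Sum>k<Suc n. bidiag x i k * (\<Sum>l<Suc n. bidiag x j l * gram x k l)))"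
    by (rule det_unit_lower_triangular_congruence[symmetric]) (auto simp: bidiag_def)
  also have "mat (Suc n) (Suc n) (\<lambda>(i, j). \<Sum>k<Suc n. bidiag x i k * (\<Sum>l<Suc n. bidiag x j l * gram x k l))
      = mat (Suc n) (Suc n) (\<lambda>(i, j). cheb4_band x i j)"
    by (rule eq_matI) (simp_all only: bidiag_gram dim_row_mat dim_col_mat index_mat split)
  finally show ?thesis
    by (simp only: det_cheb4_band)
qed

lemma hankel_det_moments:
  "hankel_det (\<lambda>k. \<Sum>m\<le>k. of_nat ((2 * k + 2) choose (k - m)) * x ^ m) n = (- 1) ^ n * cheb4 x n"
proof -
  \<comment> \<open>The coefficient of \<open>p\<^sub>k\<close> in \<open>u\<^sup>i\<close>, a unitriangular array.\<close>
  define L where "L i k = (of_nat ((2 * i + 1) choose (i + 1 + k)) :: 'a)" for i k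
  have transform: "binom_transform i f = (\<Sum>k<Suc n. L i k * f k)" if "i < Suc n" for i f
    unfolding binom_transform_def L_def
    using that by (intro sum.mono_neutral_left) (auto simp: binomial_eq_0)
  have "mat (Suc n) (Suc n) (\<lambda>(i, j). \<Sum>m\<le>i + j. of_nat ((2 * (i + j) + 2) choose (i + j - m)) * x ^ m)
      = mat (Suc n) (Suc n) (\<lambda>(i, j). \<Sum>k<Suc n. L i k * (\<Sum>l<Suc n. L j l * gram x k l))"
    by (rule eq_matI)
      (simp_all only: binom_transform_gram[symmetric] transform dim_row_mat dim_col_mat index_mat split)
  moreover have "det (mat (Suc n) (Suc n) (\<lambda>(i, j). \<Sum>k<Suc n. L i k * (\<Sum>l<Suc n. L j l * gram x k l)))
      = det (mat (Suc n) (Suc n) (\<lambda>(i, j). gram x i j))"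
    by (rule det_unit_lower_triangular_congruence)
      (simp_all add: L_def binomial_eq_0 mult_2 del: binomial_Suc_Suc)
  ultimately show ?thesis
    by (simp only: hankel_det_def det_gram Suc_eq_plus1[symmetric])
qed

lemma monom_of_nat: "Polynomial.monom (of_nat c :: 'a::comm_ring_1) m = of_nat c * [:0, 1:] ^ m"
  by (simp add: monom_altdef of_nat_poly)

lemma H_poly_eq_cheb4: "H_poly n = (- 1) ^ n * cheb4 [:0, 1:] n"
proof -
  have eq: "a_poly = (\<lambda>k. \<Sum>m\<le>k. of_nat ((2 * k + 2) choose (k - m)) * [:0, 1:] ^ m)"
    by (simp only: fun_eq_iff a_poly_def monom_of_nat atLeast0AtMost) simp
  show ?thesis
    unfolding H_poly_def eq by (rule hankel_det_moments)
qed

lemma H21_poly_eq_cheb4: "H21_poly n = (- 1) ^ n * cheb4 [:- 1, 1:] n"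
proof -
  have x: "[:0, 1:] = [:- 1, 1:] + (1 :: real poly)"
    by (simp add: one_pCons)
  have eq: "a21_poly = (\<lambda>k. \<Sum>m\<le>k. of_nat ((2 * k + 2) choose (k - m)) * [:- 1, 1:] ^ m)"
    by (simp only: fun_eq_iff a21_poly_def monom_of_nat atLeast0AtMost x a21_sum_shift) simp
  show ?thesis
    unfolding H21_poly_def eq by (rule hankel_det_moments)
qed

section \<open>The Jacobi polynomials\<close>

lemma gbinomial_minus_half:
  "(real (s + d) - 1 / 2) gchoose s
     = fact (2 * (s + d)) * fact d / (4 ^ s * fact (s + d) * fact s * fact (2 * d))"
proof (induction s arbitrary: d)
  case (Suc s)
  define A where "A = real (Suc s + d) - 1 / 2"
  have "real (Suc s) * (A gchoose Suc s) = (A - real s) * (A gchoose s)"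
    using gbinomial_mult_1[of A s] by (simp add: algebra_simps)
  also have "A gchoose s = fact (2 * (s + Suc d)) * fact (Suc d) / (4 ^ s * fact (s + Suc d) * fact s * fact (2 * Suc d))"
    using Suc.IH[of "Suc d"] by (simp add: A_def)
  also have "A - real s = (2 * real d + 1) / 2"
    by (simp add: A_def field_simps)
  also have "fact (2 * Suc d) = (2 * real d + 2) * (2 * real d + 1) * fact (2 * d)"
    by (simp add: algebra_simps)
  also have "fact (Suc d) = (real d + 1) * fact d"
    by simp
  finally have "real (Suc s) * (A gchoose Suc s) =
     (2 * real d + 1) / 2 * (fact (2 * (s + Suc d)) * ((real d + 1) * fact d) / (4 ^ s * fact (s + Suc d) * fact s * ((2 * real d + 2) * (2 * real d + 1) * fact (2 * d))))" .
  also have "\<dots> = real (Suc s) * (fact (2 * (Suc s + d)) * fact d / (4 ^ Suc s * fact (Suc s + d) * fact (Suc s) * fact (2 * d)))"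
  proof -
    have "2 * real d + 1 \<noteq> 0" "real d + 1 \<noteq> 0" "2 * real d + 2 = 2 * (real d + 1)" "fact (Suc s) = real (Suc s) * fact s"
      by (simp_all add: add_nonneg_eq_0_iff)
    then show ?thesis
      by (simp only: add_Suc add_Suc_right) (simp add: divide_simps del: fact_Suc mult_Suc_right)
  qed
  finally show ?case
    unfolding A_def[symmetric] by (simp only: mult_cancel_left of_nat_eq_0_iff) simp
qed simp

text \<open>Up to the normalizing factor, the coefficients of \<open>P\<^sub>n\<close> with parameters \<open>1/2\<close> and \<open>-1/2\<close> in powers
  of \<open>(x - 1)/2\<close> and \<open>(x + 1)/2\<close> are odd-indexed binomial coefficients.\<close>

lemma jacobi_coefficient:
  assumes "s \<le> n"
  shows "4 ^ n * (fact n)\<^sup>2 / fact (2 * n)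
      * (((real n + 1 / 2) gchoose (n - s)) * ((real n + - 1 / 2) gchoose s))
    = real ((2 * n + 1) choose (2 * s + 1))"
proof -
  obtain d where n: "n = s + d"
    using assms le_Suc_ex by blast
  have 1: "(real n + - 1 / 2) gchoose s = fact (2 * n) * fact d / (4 ^ s * fact n * fact s * fact (2 * d))"
    using gbinomial_minus_half[of s d] by (simp add: n)
  have "(real n + 1 / 2) gchoose (n - s) = fact (2 * Suc n) * fact (Suc s) / (4 ^ d * fact (Suc n) * fact d * fact (2 * Suc s))"
    using gbinomial_minus_half[of d "Suc s"]
    by (simp add: n add_ac del: fact_Suc mult_Suc_right)
  also have "fact (2 * Suc n) = (2 * real n + 2) * fact (2 * n + 1)"
    by (simp add: algebra_simps)
  also have "fact (2 * Suc s) = (2 * real s + 2) * fact (2 * s + 1)"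
    by (simp add: algebra_simps)
  also have "fact (Suc n) = (real n + 1) * fact n"
    by simp
  also have "fact (Suc s) = (real s + 1) * fact s"
    by simp
  finally have 2: "(real n + 1 / 2) gchoose (n - s) = (2 * real n + 2) * fact (2 * n + 1) * ((real s + 1) * fact s) /
      (4 ^ d * ((real n + 1) * fact n) * fact d * ((2 * real s + 2) * fact (2 * s + 1)))" .
  have 3: "real ((2 * n + 1) choose (2 * s + 1)) = fact (2 * n + 1) / (fact (2 * s + 1) * fact (2 * d))"
    using binomial_fact[of "2 * s + 1" "2 * n + 1", where 'a = real] by (simp add: n del: fact_Suc)
  have nz: "real n + 1 \<noteq> 0" "real s + 1 \<noteq> 0"
    by linarith+
  have e: "2 * real n + 2 = 2 * (real n + 1)" "2 * real s + 2 = 2 * (real s + 1)" "(4::real) ^ n = 4 ^ s * 4 ^ d"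
    by (simp_all add: n power_add)
  show ?thesis
    unfolding 1 2 3 e using nz by (simp add: divide_simps power2_eq_square mult_ac del: fact_Suc) (simp add: algebra_simps)
qed

lemma odd_binomial_sum:
  fixes p q :: "'a::comm_ring_1"
  shows "(p + q) ^ (2 * n + 1) - (p - q) ^ (2 * n + 1)
      = 2 * q * (\<Sum>s\<le>n. of_nat ((2 * n + 1) choose (2 * s + 1)) * (q\<^sup>2) ^ s * (p\<^sup>2) ^ (n - s))"
proof -
  have binom: "(p + r) ^ (2 * n + 1) = (\<Sum>s\<le>n. of_nat ((2 * n + 1) choose (2 * s)) * (r\<^sup>2) ^ s * p ^ (2 * n + 1 - 2 * s))
      + r * (\<Sum>s\<le>n. of_nat ((2 * n + 1) choose (2 * s + 1)) * (r\<^sup>2) ^ s * (p\<^sup>2) ^ (n - s))" for r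
    using binomial_ring[of r p "Suc (2 * n)"]
    by (simp only: sum.in_pairs_0) (simp add: sum.distrib sum_distrib_left add.commute algebra_simps diff_mult_distrib2 flip: power_mult)
  show ?thesis
    using binom[of q] binom[of "- q"] by (simp only: power2_minus) (simp add: algebra_simps del: binomial_Suc_Suc)
qed

text \<open>With \<open>p\<close>, \<open>q\<close> the square roots of \<open>(y + 1)/2\<close> and \<open>(y - 1)/2\<close>, the squares of \<open>p \<plusminus> q\<close> are the roots of
  \<open>t\<^sup>2 - 2 y t + 1\<close>, so the odd powers of \<open>p \<plusminus> q\<close> satisfy the recurrence of \<open>W\<^sub>n\<close>.\<close>

lemma cheb4_eq_sum:
  fixes y :: real
  assumes "y > 1"
  shows "cheb4 y n = (\<Sum>s\<le>n. of_nat ((2 * n + 1) choose (2 * s + 1)) * ((y - 1) / 2) ^ s * ((y + 1) / 2) ^ (n - s))"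
proof -
  define p where "p = sqrt ((y + 1) / 2)"
  define q where "q = sqrt ((y - 1) / 2)"
  have p2: "p\<^sup>2 = (y + 1) / 2" and q2: "q\<^sup>2 = (y - 1) / 2" and "q \<noteq> 0"
    using assms by (simp_all add: p_def q_def)
  have y: "y = p\<^sup>2 + q\<^sup>2" and pq: "p\<^sup>2 - q\<^sup>2 = 1"
    by (simp_all add: p2 q2 field_simps)
  have root: "(r\<^sup>2)\<^sup>2 = 2 * y * r\<^sup>2 - 1" if "r = p + q \<or> r = p - q" for r
  proof -
    have "(r\<^sup>2)\<^sup>2 - 2 * y * r\<^sup>2 + (p\<^sup>2 - q\<^sup>2)\<^sup>2 = 0"
      using that unfolding y by (auto simp: power2_eq_square algebra_simps)
    then show ?thesis
      by (simp add: pq)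
  qed
  have step: "r ^ (2 * Suc (Suc n) + 1) = 2 * y * r ^ (2 * Suc n + 1) - r ^ (2 * n + 1)"
    if "r = p + q \<or> r = p - q" for r n
  proof -
    have "r ^ (2 * Suc (Suc n) + 1) = (r\<^sup>2)\<^sup>2 * r ^ (2 * n + 1)"
      by (simp add: power2_eq_square mult_ac)
    also have "\<dots> = 2 * y * r ^ (2 * Suc n + 1) - r ^ (2 * n + 1)"
      unfolding root[OF that] by (simp add: power2_eq_square algebra_simps)
    finally show ?thesis .
  qed
  have "2 * q * cheb4 y n = (p + q) ^ (2 * n + 1) - (p - q) ^ (2 * n + 1)"
  proof (induction n rule: induct_nat_012)
    case 1
    have "2 * q * (2 * y + 1) = 2 * q * (2 * (p\<^sup>2 + q\<^sup>2) + (p\<^sup>2 - q\<^sup>2))"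
      by (simp only: y[symmetric] pq)
    also have "\<dots> = (p + q) ^ 3 - (p - q) ^ 3"
      by (simp add: power2_eq_square power3_eq_cube algebra_simps)
    finally show ?case
      by (simp add: numeral_3_eq_3)
  next
    case (ge2 n)
    have "2 * q * cheb4 y (Suc (Suc n)) = 2 * y * (2 * q * cheb4 y (Suc n)) - 2 * q * cheb4 y n"
      by (simp add: algebra_simps)
    also have "\<dots> = 2 * y * ((p + q) ^ (2 * Suc n + 1) - (p - q) ^ (2 * Suc n + 1))
        - ((p + q) ^ (2 * n + 1) - (p - q) ^ (2 * n + 1))"
      by (simp only: ge2)
    also have "\<dots> = (2 * y * (p + q) ^ (2 * Suc n + 1) - (p + q) ^ (2 * n + 1))
        - (2 * y * (p - q) ^ (2 * Suc n + 1) - (p - q) ^ (2 * n + 1))"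
      by (simp only: right_diff_distrib diff_diff_eq diff_diff_eq2 add_ac)
    also have "\<dots> = (p + q) ^ (2 * Suc (Suc n) + 1) - (p - q) ^ (2 * Suc (Suc n) + 1)"
      by (simp only: step simp_thms)
    finally show ?case .
  qed simp
  then show ?thesis
    using \<open>q \<noteq> 0\<close> unfolding odd_binomial_sum p2 q2 by simp
qed

lemma jacobi_eq_cheb4:
  "Polynomial.smult (4 ^ n * (fact n)\<^sup>2 / fact (2 * n)) (jacobi_poly (1 / 2) (- 1 / 2) n) = cheb4 [:0, 1:] n"
  (is "?P = ?W")
proof (rule ccontr)
  \<comment> \<open>Two polynomials that agree on the infinite set \<open>y > 1\<close> are equal.\<close>
  assume "?P \<noteq> ?W"
  then have "finite {y. poly (?P - ?W) y = 0}"
    by (intro poly_roots_finite) simp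
  moreover have "{1<..} \<subseteq> {y. poly (?P - ?W) y = 0}"
  proof safe
    fix y :: real
    assume "y > 1"
    have "poly ?P y = (\<Sum>s\<le>n. 4 ^ n * (fact n)\<^sup>2 / fact (2 * n)
      * (((real n + 1 / 2) gchoose (n - s)) * ((real n + - 1 / 2) gchoose s)) * ((y - 1) / 2) ^ s * ((y + 1) / 2) ^ (n - s))"
      unfolding jacobi_poly_def poly_smult poly_sum sum_distrib_left atLeast0AtMost
      by (intro sum.cong refl) (simp add: diff_divide_distrib add_divide_distrib add.commute)
    also have "\<dots> = cheb4 y n"
      unfolding cheb4_eq_sum[OF \<open>y > 1\<close>] by (intro sum.cong refl) (simp only: jacobi_coefficient atMost_iff)
    finally show "poly (?P - ?W) y = 0"
      by (simp add: poly_cheb4)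
  qed
  ultimately show False
    using infinite_Ioi finite_subset by blast
qed

section \<open>Jacobi's differential equation\<close>

text \<open>The derivative through the next polynomial, scaled by \<open>2\<close> to keep the coefficients integral.\<close>

lemma cheb4_deriv:
  defines "x \<equiv> [:0, 1:] :: real poly"
  shows "2 * (x\<^sup>2 - 1) * pderiv (cheb4 x n)
      = (2 * of_nat n + 1) * cheb4 x (Suc n) - (2 * (of_nat n + 1) * x + 1) * cheb4 x n"
proof -
  have dx: "pderiv x = 1"
    by (simp add: x_def pderiv_pCons)
  have d2: "pderiv 2 = (0 :: real poly)"
    using pderiv_of_nat[of 2, where 'a = real] by simp
  show ?thesis
  proof (induction n rule: induct_nat_012)
    case 0
    show ?case by simp
  next
    case 1
    show ?case
      by (simp add: pderiv_add pderiv_mult dx d2 power2_eq_square algebra_simps)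
  next
    case (ge2 n)
    define N where "N = (of_nat n :: real poly)"
    have d: "pderiv (cheb4 x (Suc (Suc n)))
        = 2 * cheb4 x (Suc n) + 2 * x * pderiv (cheb4 x (Suc n)) - pderiv (cheb4 x n)"
      by (simp add: pderiv_diff pderiv_mult dx d2 algebra_simps)
    have N: "of_nat (Suc n) = N + 1" "of_nat (Suc (Suc n)) = N + 2"
      by (simp_all add: N_def)
    have rec: "cheb4 x (Suc (Suc (Suc n))) = 2 * x * cheb4 x (Suc (Suc n)) - cheb4 x (Suc n)"
        "cheb4 x (Suc (Suc n)) = 2 * x * cheb4 x (Suc n) - cheb4 x n"
      by simp_all
    have "2 * (x\<^sup>2 - 1) * pderiv (cheb4 x (Suc (Suc n)))
        = 4 * (x\<^sup>2 - 1) * cheb4 x (Suc n) + 2 * x * (2 * (x\<^sup>2 - 1) * pderiv (cheb4 x (Suc n)))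
          - 2 * (x\<^sup>2 - 1) * pderiv (cheb4 x n)"
      unfolding d by (simp add: algebra_simps)
    also have "\<dots> = (2 * (N + 2) + 1) * cheb4 x (Suc (Suc (Suc n))) - (2 * (N + 2 + 1) * x + 1) * cheb4 x (Suc (Suc n))"
      unfolding ge2 N N_def[symmetric] rec by (simp add: power2_eq_square algebra_simps)
    finally show ?case
      by (simp only: N)
  qed
qed

text \<open>Differentiate the formula for \<open>W\<^sub>n'\<close> and eliminate \<open>W\<^sub>n\<^sub>+\<^sub>1\<close> and its derivative.\<close>

lemma cheb4_ode:
  defines "x \<equiv> [:0, 1:] :: real poly"
  shows "(x\<^sup>2 - 1) * pderiv (pderiv (cheb4 x n)) + (2 * x + 1) * pderiv (cheb4 x n)
    - of_nat n * (of_nat n + 1) * cheb4 x n = 0"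
proof -
  define N where "N = (of_nat n :: real poly)"
  define W where "W = cheb4 x n"
  define V where "V = cheb4 x (Suc n)"
  have dx: "pderiv x = 1"
    by (simp add: x_def pderiv_pCons)
  have const: "pderiv N = 0" "pderiv 2 = (0 :: real poly)"
    using pderiv_of_nat[of 2, where 'a = real] by (simp_all add: N_def)
  have W: "2 * (x\<^sup>2 - 1) * pderiv W = (2 * N + 1) * V - (2 * (N + 1) * x + 1) * W"
    using cheb4_deriv[of n] by (simp only: x_def[symmetric] N_def V_def W_def)
  \<comment> \<open>The same formula for \<open>n + 1\<close>, with \<open>W\<^sub>n\<^sub>+\<^sub>2\<close> replaced by \<open>2 x W\<^sub>n\<^sub>+\<^sub>1 - W\<^sub>n\<close>.\<close>
  have V: "2 * (x\<^sup>2 - 1) * pderiv V = (2 * (N + 1) * x - 1) * V - (2 * N + 3) * W"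
    using cheb4_deriv[of "Suc n"] by (simp add: x_def[symmetric] N_def V_def W_def algebra_simps)
  have "pderiv (2 * (x\<^sup>2 - 1) * pderiv W) = pderiv ((2 * N + 1) * V - (2 * (N + 1) * x + 1) * W)"
    by (simp only: W)
  then have dW: "4 * x * pderiv W + 2 * (x\<^sup>2 - 1) * pderiv (pderiv W)
      = (2 * N + 1) * pderiv V - 2 * (N + 1) * W - (2 * (N + 1) * x + 1) * pderiv W"
    by (simp add: pderiv_mult pderiv_add pderiv_diff power2_eq_square dx const algebra_simps)
  \<comment> \<open>A multiple of the goal as a combination of \<open>dW\<close>, \<open>V\<close> and \<open>W\<close>, the facts named so: the second
    eliminates \<open>W\<^sub>n\<^sub>+\<^sub>1'\<close>, the third \<open>W\<^sub>n\<^sub>+\<^sub>1\<close>.\<close>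
  have "4 * (x\<^sup>2 - 1) * ((x\<^sup>2 - 1) * pderiv (pderiv W) + (2 * x + 1) * pderiv W - N * (N + 1) * W)
      = 2 * (x\<^sup>2 - 1) * ((4 * x * pderiv W + 2 * (x\<^sup>2 - 1) * pderiv (pderiv W))
          - ((2 * N + 1) * pderiv V - 2 * (N + 1) * W - (2 * (N + 1) * x + 1) * pderiv W))
        + (2 * N + 1) * (2 * (x\<^sup>2 - 1) * pderiv V - ((2 * (N + 1) * x - 1) * V - (2 * N + 3) * W))
        - (2 * (N + 1) * x - 1) * (2 * (x\<^sup>2 - 1) * pderiv W - ((2 * N + 1) * V - (2 * (N + 1) * x + 1) * W))"
    by (simp add: power2_eq_square algebra_simps)
  then have "4 * (x\<^sup>2 - 1) * ((x\<^sup>2 - 1) * pderiv (pderiv W) + (2 * x + 1) * pderiv W - N * (N + 1) * W) = 0"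
    unfolding W V dW by simp
  moreover have "4 * (x\<^sup>2 - 1) \<noteq> 0"
  proof
    assume "4 * (x\<^sup>2 - 1) = 0"
    then have "poly (4 * (x\<^sup>2 - 1)) 0 = 0" by simp
    then show False by (simp add: x_def)
  qed
  ultimately show ?thesis
    by (simp only: W_def N_def mult_eq_0_iff) blast
qed

section \<open>The Hankel determinants as Jacobi polynomials\<close>

theorem corollary8:
  fixes n :: nat
  shows "[:- 1, 0, 1:] * pderiv (pderiv (H_poly n)) + [:1, 2:] * pderiv (H_poly n)
           - Polynomial.smult (real n * (real n + 1)) (H_poly n) = 0
    \<and> H_poly n = Polynomial.smult ((- 4) ^ n * (fact n)\<^sup>2 / fact (2 * n))
           (jacobi_poly (1 / 2) (- 1 / 2) n)
    \<and> H21_poly n = Polynomial.smult ((- 4) ^ n * (fact n)\<^sup>2 / fact (2 * n))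
           (pcompose (jacobi_poly (1 / 2) (- 1 / 2) n) [:- 1, 1:])"
proof (intro conjI)
  define x where "x = [:0, 1 :: real:]"
  define W where "W = cheb4 x n"
  define c where "c = 4 ^ n * (fact n)\<^sup>2 / (fact (2 * n) :: real)"
  have H: "H_poly n = Polynomial.smult ((- 1) ^ n) W"
    by (cases "even n") (simp_all add: H_poly_eq_cheb4 W_def x_def)
  have H21: "H21_poly n = Polynomial.smult ((- 1) ^ n) (pcompose W [:- 1, 1:])"
    by (cases "even n") (simp_all add: H21_poly_eq_cheb4 W_def x_def pcompose_cheb4 pcompose_pCons)
  have jacobi: "W = Polynomial.smult c (jacobi_poly (1 / 2) (- 1 / 2) n)"
    by (simp only: W_def x_def c_def jacobi_eq_cheb4)
  have sign: "(- 4) ^ n * (fact n)\<^sup>2 / fact (2 * n) = (- 1) ^ n * c"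
    by (simp add: c_def power_minus[of 4])
  show "H_poly n = Polynomial.smult ((- 4) ^ n * (fact n)\<^sup>2 / fact (2 * n))
      (jacobi_poly (1 / 2) (- 1 / 2) n)"
    by (simp add: H jacobi sign)
  show "H21_poly n = Polynomial.smult ((- 4) ^ n * (fact n)\<^sup>2 / fact (2 * n))
      (pcompose (jacobi_poly (1 / 2) (- 1 / 2) n) [:- 1, 1:])"
    by (simp add: H21 jacobi sign pcompose_smult)
  have coeffs: "[:- 1, 0, 1:] = x\<^sup>2 - 1" "[:1, 2:] = 2 * x + 1"
    by (simp_all add: x_def power2_eq_square one_pCons numeral_poly)
  have "Polynomial.smult (real n * (real n + 1)) W = of_nat n * (of_nat n + 1) * W"
    by (simp add: of_nat_poly one_pCons mult.commute)
  then have "[:- 1, 0, 1:] * pderiv (pderiv W) + [:1, 2:] * pderiv W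
      - Polynomial.smult (real n * (real n + 1)) W = 0"
    using cheb4_ode[of n] by (simp only: coeffs W_def x_def)
  then have "Polynomial.smult ((- 1) ^ n) ([:- 1, 0, 1:] * pderiv (pderiv W) + [:1, 2:] * pderiv W
      - Polynomial.smult (real n * (real n + 1)) W) = 0"
    by (simp only: smult_0_right)
  then show "[:- 1, 0, 1:] * pderiv (pderiv (H_poly n)) + [:1, 2:] * pderiv (H_poly n)
      - Polynomial.smult (real n * (real n + 1)) (H_poly n) = 0"
    by (simp only: H pderiv_smult mult_smult_right smult_add_right smult_diff_right smult_smult mult.commute)
qed

end
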